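(* Let $\Lambda$ be a numerical semigroup and define $m(\delta)=\max\{i\in\mathbb{N}_0\mid\nu_i<\delta\}$. There exists at least one value of $\delta\in\mathbb{N}_0$ (with $m(\delta)$ defined, i.e. $\{i\in\mathbb{N}_0\mid\nu_i<\delta\}\neq\emptyset$) for which $$\{i\in\mathbb{N}_0\mid\nu_i<\delta\}\subsetneq\{i\in\mathbb{N}_0\mid i\leq m(\delta)\}$$ if and only if $\Lambda$ is non-ordinary.
   Context: $\mathbb{N}_0$ is the set of non-negative integers. A numerical semigroup is a subset $\Lambda\subseteq\mathbb{N}_0$ containing $0$, closed under addition, with finite complement in $\mathbb{N}_0$. The enumeration of $\Lambda$ is the unique increasing bijection $\lambda:\mathbb{N}_0\to\Lambda$, written $\lambda_i=\lambda(i)$. For $i\in\mathbb{N}_0$, $\nu_i=\#\{j\in\mathbb{N}_0\mid\lambda_i-\lambda_j\in\Lambda\}$. For each $\delta$ the set $\{i\mid\nu_i<\delta\}$ is finite, so $m(\delta)$ is defined whenever this set is non-empty. $\Lambda$ is ordinary if $\Lambda=\{0\}\cup\{i\in\mathbb{N}_0\mid i\geq c\}$ for some non-negative integer $c$, and non-ordinary otherwise. *)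

theory Defs
  imports Main "HOL-Library.Infinite_Set"
begin

definition numerical_semigroup :: "nat set \<Rightarrow> bool" where
  "numerical_semigroup \<Lambda> \<longleftrightarrow>
     0 \<in> \<Lambda> \<and> (\<forall>a\<in>\<Lambda>. \<forall>b\<in>\<Lambda>. a + b \<in> \<Lambda>) \<and> finite (- \<Lambda>)"

(* The enumeration i \<mapsto> \<lambda>_i of a numerical semigroup is the library's enumerate \<Lambda>, which for
   an infinite set is its increasing bijection from nat (strict_mono_enumerate, range_enumerate).
   The difference is taken in the integers: truncated subtraction on nat would
   give 0 \<in> \<Lambda> for every j with \<lambda>_j > \<lambda>_i. *)
definition nu :: "nat set \<Rightarrow> nat \<Rightarrow> nat" where
  "nu \<Lambda> i = card {j. int (enumerate \<Lambda> i) - int (enumerate \<Lambda> j) \<in> int ` \<Lambda>}"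

(* Meaningful when the set is non-empty; for a numerical semigroup it is always finite. *)
definition m :: "nat set \<Rightarrow> nat \<Rightarrow> nat" where
  "m \<Lambda> \<delta> = Max {i. nu \<Lambda> i < \<delta>}"

definition ordinary :: "nat set \<Rightarrow> bool" where
  "ordinary \<Lambda> \<longleftrightarrow> (\<exists>c. \<Lambda> = {0} \<union> {i. i \<ge> c})"

end

(* Split the pairs of elements of \<Lambda> with sum x according to which entry is smaller.
   This gives nu = 2 l + e, where l counts the a \<in> \<Lambda> with 2 a < x and x - a \<in> \<Lambda>, and e \<in> {0, 1}
   says whether x is the double of an element. Let h \<ge> l count all a \<in> \<Lambda> with 2 a < x. From one
   element of \<Lambda> to the next, h grows by e, and e is never 1 twice in a row because a + b lies
   strictly between 2 a and 2 b. So if nu is nondecreasing, then by parity l keeps up with h,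
   hence l = h throughout: x - a \<in> \<Lambda> whenever a, x \<in> \<Lambda> and 2 a < x. If \<Lambda> is not
   ordinary, then its largest gap F exceeds some positive a \<in> \<Lambda>, and x = F + a violates this. *)

theory Submission
  imports Defs
begin

lemma numerical_semigroup_infinite:
  assumes "numerical_semigroup \<Lambda>"
  shows "infinite \<Lambda>"
proof
  assume "finite \<Lambda>"
  then have "finite (\<Lambda> \<union> - \<Lambda>)"
    using assms unfolding numerical_semigroup_def by blast
  then show False by simp
qed

lemma numerical_semigroup_conductor:
  assumes "numerical_semigroup \<Lambda>"
  obtains c where "\<And>x. x \<ge> c \<Longrightarrow> x \<in> \<Lambda>"
proof -
  have "finite (- \<Lambda>)" using assms unfolding numerical_semigroup_def by blast
  then obtain c where "\<forall>x\<in>- \<Lambda>. x < c"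
    unfolding finite_nat_set_iff_bounded by blast
  then have "x \<in> \<Lambda>" if "x \<ge> c" for x using that by (meson ComplI not_less)
  then show ?thesis using that by blast
qed

text \<open>\<open>enumerate \<Lambda>\<close> is injective with range \<open>\<Lambda>\<close>, so
  indices can be traded for elements; the guard \<open>a \<le> enumerate \<Lambda> i\<close> makes
  the truncated subtraction exact.\<close>

lemma nu_eq_card:
  assumes "infinite \<Lambda>"
  shows "nu \<Lambda> i = card {a \<in> \<Lambda>. a \<le> enumerate \<Lambda> i \<and> enumerate \<Lambda> i - a \<in> \<Lambda>}"
proof -
  let ?e = "enumerate \<Lambda>"
  have diff: "int x - int y \<in> int ` \<Lambda> \<longleftrightarrow> y \<le> x \<and> x - y \<in> \<Lambda>" for x y
  proof
    assume "int x - int y \<in> int ` \<Lambda>"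
    then obtain z where "z \<in> \<Lambda>" "int x - int y = int z" by blast
    then have "y \<le> x" "x - y = z" by linarith+
    then show "y \<le> x \<and> x - y \<in> \<Lambda>" using \<open>z \<in> \<Lambda>\<close> by simp
  next
    assume "y \<le> x \<and> x - y \<in> \<Lambda>"
    then show "int x - int y \<in> int ` \<Lambda>" by (intro image_eqI[of _ _ "x - y"]) auto
  qed
  have "inj ?e" using strict_mono_enumerate[OF assms] by (rule strict_mono_imp_inj_on)
  then have "nu \<Lambda> i = card (?e ` {j. ?e j \<le> ?e i \<and> ?e i - ?e j \<in> \<Lambda>})"
    unfolding nu_def diff by (simp add: card_image inj_on_subset)
  also have "?e ` {j. ?e j \<le> ?e i \<and> ?e i - ?e j \<in> \<Lambda>} = {a \<in> \<Lambda>. a \<le> ?e i \<and> ?e i - a \<in> \<Lambda>}"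
    using range_enumerate[OF assms] by (auto simp: image_iff)
  finally show ?thesis .
qed

text \<open>This makes the \<open>Max\<close> in \<open>m\<close> meaningful. Beyond the conductor
  every sum of two large summands counts, so \<open>nu\<close> tends to infinity.\<close>

lemma finite_nu_less:
  assumes "numerical_semigroup \<Lambda>"
  shows "finite {i. nu \<Lambda> i < \<delta>}"
proof -
  have inf: "infinite \<Lambda>" using numerical_semigroup_infinite[OF assms] .
  obtain c where c: "\<And>x. x \<ge> c \<Longrightarrow> x \<in> \<Lambda>"
    using numerical_semigroup_conductor[OF assms] by blast
  have "i < 2 * c + \<delta>" if "nu \<Lambda> i < \<delta>" for i
  proof (rule ccontr)
    assume "\<not> i < 2 * c + \<delta>"
    moreover have "i \<le> enumerate \<Lambda> i" using le_enumerate[OF inf] .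
    ultimately have big: "2 * c + \<delta> \<le> enumerate \<Lambda> i" by simp
    \<comment> \<open>Each such \<open>a\<close> is at least \<open>c\<close>, and since
      \<open>enumerate \<Lambda> i\<close> is at least \<open>2 * c + \<delta>\<close>, so is its
      complement.\<close>
    have "{c..<c + \<delta>} \<subseteq> {a \<in> \<Lambda>. a \<le> enumerate \<Lambda> i \<and> enumerate \<Lambda> i - a \<in> \<Lambda>}"
      using big by (auto intro!: c)
    then have "card {c..<c + \<delta>} \<le> nu \<Lambda> i"
      unfolding nu_eq_card[OF inf] by (intro card_mono) auto
    then show False using that by simp
  qed
  then show ?thesis by (auto intro: finite_subset[of _ "{..<2 * c + \<delta>}"])
qed

lemma ordinary_imp_mono_nu:
  assumes "infinite \<Lambda>" and "ordinary \<Lambda>"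
  shows "mono (nu \<Lambda>)"
proof (rule monoI)
  fix i j :: nat
  assume "i \<le> j"
  define x y where "x = enumerate \<Lambda> i" and "y = enumerate \<Lambda> j"
  obtain c where c: "\<Lambda> = {0} \<union> {i. i \<ge> c}" using assms(2) unfolding ordinary_def by blast
  have "x \<le> y"
    using \<open>i \<le> j\<close> strict_mono_enumerate[OF assms(1)]
    unfolding x_def y_def by (simp add: strict_mono_less_eq)
  have "y \<in> \<Lambda>" unfolding y_def using assms(1) by (rule enumerate_in_set)
  \<comment> \<open>For \<open>a < x\<close> the difference \<open>x - a\<close> is nonzero, hence
    at least \<open>c\<close>, and so is \<open>y - a\<close>. For \<open>a = x\<close> the
    difference is 0, and \<open>y\<close> takes the place of \<open>x\<close>.\<close>
  let ?f = "\<lambda>a. if a = x then y else a"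
  have "card {a \<in> \<Lambda>. a \<le> x \<and> x - a \<in> \<Lambda>} \<le> card {a \<in> \<Lambda>. a \<le> y \<and> y - a \<in> \<Lambda>}"
  proof (rule card_inj_on_le[of ?f])
    show "inj_on ?f {a \<in> \<Lambda>. a \<le> x \<and> x - a \<in> \<Lambda>}"
      using \<open>x \<le> y\<close> by (auto simp: inj_on_def)
    show "?f ` {a \<in> \<Lambda>. a \<le> x \<and> x - a \<in> \<Lambda>} \<subseteq> {a \<in> \<Lambda>. a \<le> y \<and> y - a \<in> \<Lambda>}"
      using \<open>x \<le> y\<close> \<open>y \<in> \<Lambda>\<close> by (auto simp: c)
  qed simp
  then show "nu \<Lambda> i \<le> nu \<Lambda> j"
    unfolding nu_eq_card[OF assms(1)] x_def y_def .
qed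

lemma card_halves:
  fixes \<Lambda> :: "nat set"
  shows "card {a \<in> \<Lambda>. x = 2 * a} = of_bool (\<exists>a\<in>\<Lambda>. x = 2 * a)"
proof (cases "\<exists>a\<in>\<Lambda>. x = 2 * a")
  case True
  then obtain a where "a \<in> \<Lambda>" "x = 2 * a" by blast
  then have "{a \<in> \<Lambda>. x = 2 * a} = {a}" by auto
  then show ?thesis using True by simp
next
  case False
  then have "{a \<in> \<Lambda>. x = 2 * a} = {}" by blast
  then show ?thesis using False by (simp only: card.empty) simp
qed

lemma card_summands_split:
  fixes \<Lambda> :: "nat set"
  shows "card {a \<in> \<Lambda>. a \<le> x \<and> x - a \<in> \<Lambda>} =
    2 * card {a \<in> \<Lambda>. 2 * a < x \<and> x - a \<in> \<Lambda>} + of_bool (\<exists>a\<in>\<Lambda>. x = 2 * a)"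
proof -
  let ?L = "{a \<in> \<Lambda>. 2 * a < x \<and> x - a \<in> \<Lambda>}"
  let ?R = "{a \<in> \<Lambda>. x < 2 * a \<and> a \<le> x \<and> x - a \<in> \<Lambda>}"
  let ?M = "{a \<in> \<Lambda>. x = 2 * a}"
  have split: "{a \<in> \<Lambda>. a \<le> x \<and> x - a \<in> \<Lambda>} = (?L \<union> ?R) \<union> ?M"
    by auto
  have fin: "finite ?L" "finite ?R" "finite ?M"
    by (auto intro: finite_subset[of _ "{..x}"])
  \<comment> \<open>Reflection about \<open>x / 2\<close> is an involution exchanging the smaller
    and the larger summands.\<close>
  have "bij_betw (\<lambda>a. x - a) ?L ?R"
    by (rule bij_betw_byWitness[where f' = "\<lambda>a. x - a"]) auto
  then have R: "card ?R = card ?L" by (simp add: bij_betw_same_card)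
  have "card ((?L \<union> ?R) \<union> ?M) = card ?L + card ?R + card ?M"
  proof -
    have "(?L \<union> ?R) \<inter> ?M = {}" "?L \<inter> ?R = {}" by auto
    then show ?thesis using fin by (simp only: card_Un_disjoint finite_UnI)
  qed
  then show ?thesis unfolding split R card_halves by linarith
qed

lemma mono_nu_imp_diff_mem:
  assumes sg: "numerical_semigroup \<Lambda>" and mono: "mono (nu \<Lambda>)"
    and "x \<in> \<Lambda>" and "a \<in> \<Lambda>" and "2 * a < x"
  shows "x - a \<in> \<Lambda>"
proof -
  have inf: "infinite \<Lambda>" using numerical_semigroup_infinite[OF sg] .
  have add: "a + b \<in> \<Lambda>" if "a \<in> \<Lambda>" "b \<in> \<Lambda>" for a b
    using sg that unfolding numerical_semigroup_def by blast
  define l where "l x = card {a \<in> \<Lambda>. 2 * a < x \<and> x - a \<in> \<Lambda>}" for x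
  define h where "h x = card {a \<in> \<Lambda>. 2 * a < x}" for x
  define e :: "nat \<Rightarrow> nat" where "e x = of_bool (\<exists>a\<in>\<Lambda>. x = 2 * a)" for x
  have fin: "finite {a \<in> \<Lambda>. 2 * a < x}" for x
    by (rule finite_subset[of _ "{..x}"]) auto
  have nu: "nu \<Lambda> i = 2 * l (enumerate \<Lambda> i) + e (enumerate \<Lambda> i)" for i
    unfolding nu_eq_card[OF inf] l_def e_def by (rule card_summands_split)
  have step: "h (enumerate \<Lambda> i) \<le> l (enumerate \<Lambda> i)" for i
  proof (induction i)
    case 0
    have "enumerate \<Lambda> 0 = 0"
      using sg unfolding enumerate_0 numerical_semigroup_def by (simp add: Least_eq_0)
    then show ?case by (simp add: h_def)
  next
    case (Suc i)
    define x y where "x = enumerate \<Lambda> i" and "y = enumerate \<Lambda> (Suc i)"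
    have "x < y" unfolding x_def y_def using enumerate_step[OF inf] .
    have next_elem: "y \<le> z" if "z \<in> \<Lambda>" "x < z" for z
      unfolding y_def enumerate_Suc''[OF inf] using that unfolding x_def by (intro Least_le) simp
    \<comment> \<open>No element lies strictly between the consecutive elements \<open>x\<close> and
      \<open>y\<close>, and \<open>2 * a\<close> is an element, so \<open>2 * a < y\<close> forces
      \<open>2 * a \<le> x\<close>.\<close>
    have "{a \<in> \<Lambda>. 2 * a < y} = {a \<in> \<Lambda>. 2 * a < x} \<union> {a \<in> \<Lambda>. x = 2 * a}"
    proof -
      have "2 * a < x \<or> x = 2 * a" if "a \<in> \<Lambda>" "2 * a < y" for a
      proof (rule ccontr)
        assume "\<not> ?thesis"
        then have "x < 2 * a" by linarith
        moreover have "2 * a \<in> \<Lambda>" using add[of a a] that(1) by (simp add: mult_2)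
        ultimately show False using next_elem[of "2 * a"] that(2) by simp
      qed
      then show ?thesis using \<open>x < y\<close> by auto
    qed
    moreover have "card {a \<in> \<Lambda>. x = 2 * a} = e x"
      unfolding e_def by (rule card_halves)
    ultimately have h: "h y \<le> h x + e x"
      unfolding h_def
      using card_Un_le[of "{a \<in> \<Lambda>. 2 * a < x}" "{a \<in> \<Lambda>. x = 2 * a}"] by simp
    have not_both: "e x = 0 \<or> e y = 0"
    proof (rule ccontr)
      assume "\<not> ?thesis"
      then obtain a b where "a \<in> \<Lambda>" "b \<in> \<Lambda>" "x = 2 * a" "y = 2 * b"
        unfolding e_def by (auto split: if_splits)
      then show False using next_elem[of "a + b"] add[of a b] \<open>x < y\<close> by simp
    qed
    have "e x \<le> 1" "e y \<le> 1" by (simp_all add: e_def)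
    moreover have "nu \<Lambda> i \<le> nu \<Lambda> (Suc i)" using mono by (simp add: monoD)
    \<comment> \<open>Parity: monotonicity says \<open>2 * l x + e x \<le> 2 * l y + e y\<close>. If
      \<open>e x = 1\<close>, then \<open>e y = 0\<close> and \<open>l y\<close> exceeds
      \<open>l x\<close>; if \<open>e x = 0\<close>, then \<open>e y \<le> 1\<close> still gives
      \<open>l x \<le> l y\<close>. Either way
      \<open>l y \<ge> l x + e x \<ge> h x + e x \<ge> h y\<close>.\<close>
    ultimately show ?case
      using Suc.IH h not_both unfolding nu x_def[symmetric] y_def[symmetric] by linarith
  qed
  obtain i where i: "x = enumerate \<Lambda> i"
    using range_enumerate[OF inf] \<open>x \<in> \<Lambda>\<close> by blast
  \<comment> \<open>The left set is contained in the right one, which is finite and by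
    \<open>step\<close> no larger.\<close>
  have "{a \<in> \<Lambda>. 2 * a < x \<and> x - a \<in> \<Lambda>} = {a \<in> \<Lambda>. 2 * a < x}"
    using step[of i] unfolding i[symmetric] l_def h_def by (intro card_seteq fin) auto
  then show ?thesis using assms(4,5) by blast
qed

lemma mono_nu_imp_ordinary:
  assumes sg: "numerical_semigroup \<Lambda>" and mono: "mono (nu \<Lambda>)"
  shows "ordinary \<Lambda>"
\<comment> \<open>Without gaps there is no largest gap; this semigroup is ordinary with
  \<open>c = 0\<close>.\<close>
proof (cases "\<Lambda> = UNIV")
  case True
  then show ?thesis unfolding ordinary_def by (intro exI[of _ 0]) auto
next
  case False
  have zero: "0 \<in> \<Lambda>" and fin: "finite (- \<Lambda>)"
    using sg unfolding numerical_semigroup_def by blast+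
  define F where "F = Max (- \<Lambda>)"
  have F: "F \<notin> \<Lambda>" using Max_in[OF fin] False unfolding F_def by blast
  have above: "x \<in> \<Lambda>" if "F < x" for x
    using Max_ge[OF fin, of x] that unfolding F_def by fastforce
  have "a = 0 \<or> Suc F \<le> a" if "a \<in> \<Lambda>" for a
  proof (rule ccontr)
    assume "\<not> ?thesis"
    moreover have "a \<noteq> F" using that F by blast
    ultimately have "0 < a" "a < F" by linarith+
    \<comment> \<open>\<open>F + a\<close> lies above the largest gap, and \<open>a < F\<close>
      gives \<open>2 * a < F + a\<close>.\<close>
    then have "F + a - a \<in> \<Lambda>"
      using that above by (intro mono_nu_imp_diff_mem[OF sg mono]) auto
    then show False using F by simp
  qed
  then have "\<Lambda> = {0} \<union> {i. i \<ge> Suc F}"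
    using zero above by (auto simp: Suc_le_eq)
  then show ?thesis unfolding ordinary_def by blast
qed

text \<open>All nonempty sublevel sets of \<open>nu\<close> are initial segments exactly when
  \<open>nu\<close> is nondecreasing, which for a numerical semigroup means being ordinary.\<close>

theorem corollary7p5:
  fixes \<Lambda> :: "nat set"
  assumes "numerical_semigroup \<Lambda>"
  shows "(\<exists>\<delta>::nat. {i. nu \<Lambda> i < \<delta>} \<noteq> {} \<and> {i. nu \<Lambda> i < \<delta>} \<subset> {i. i \<le> m \<Lambda> \<delta>})
    \<longleftrightarrow> \<not> ordinary \<Lambda>"
proof
  assume "\<exists>\<delta>::nat. {i. nu \<Lambda> i < \<delta>} \<noteq> {} \<and> {i. nu \<Lambda> i < \<delta>} \<subset> {i. i \<le> m \<Lambda> \<delta>}"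
  then obtain \<delta> i where ne: "{i. nu \<Lambda> i < \<delta>} \<noteq> {}" and i: "i \<le> m \<Lambda> \<delta>" "\<not> nu \<Lambda> i < \<delta>"
    by blast
  \<comment> \<open>The maximum is attained, so \<open>nu\<close> drops between \<open>i\<close> and
    \<open>m \<Lambda> \<delta>\<close>.\<close>
  have "nu \<Lambda> (m \<Lambda> \<delta>) < \<delta>"
    using Max_in[OF finite_nu_less[OF assms] ne] unfolding m_def by simp
  then have "\<not> mono (nu \<Lambda>)" using i monoD[of "nu \<Lambda>" i "m \<Lambda> \<delta>"] by linarith
  then show "\<not> ordinary \<Lambda>"
    using ordinary_imp_mono_nu numerical_semigroup_infinite[OF assms] by blast
next
  assume "\<not> ordinary \<Lambda>"
  then have "\<not> mono (nu \<Lambda>)" using mono_nu_imp_ordinary[OF assms] by blast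
  then obtain i j where ij: "i \<le> j" "nu \<Lambda> j < nu \<Lambda> i"
    unfolding mono_def by (meson not_le)
  \<comment> \<open>Take \<open>\<delta> = nu \<Lambda> i\<close> at a descent: \<open>j\<close>
    lies in the sublevel set, while \<open>i \<le> j \<le> m \<Lambda> \<delta>\<close> is missing
    from it.\<close>
  let ?S = "{k. nu \<Lambda> k < nu \<Lambda> i}"
  have le: "k \<le> m \<Lambda> (nu \<Lambda> i)" if "nu \<Lambda> k < nu \<Lambda> i" for k
    unfolding m_def using that finite_nu_less[OF assms] by (intro Max_ge) auto
  have "i \<le> m \<Lambda> (nu \<Lambda> i)" using le[OF ij(2)] ij(1) by linarith
  then have "?S \<noteq> {} \<and> ?S \<subset> {k. k \<le> m \<Lambda> (nu \<Lambda> i)}"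
    using ij(2) le by blast
  then show "\<exists>\<delta>. {i. nu \<Lambda> i < \<delta>} \<noteq> {} \<and> {i. nu \<Lambda> i < \<delta>} \<subset> {i. i \<le> m \<Lambda> \<delta>}"
    by blast
qed

end
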